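(* Let $t$ be a positive integer. (a) Assume that $7t(3t-1)$ is neither of the form $l(3l-1)$ nor of the form $l(3l+1)$ for any $l\in\mathbb{N}$. Then the interval $[56t-29,\,14t(3t-1)-1]$ contains an integer $n\equiv 3\pmod 4$ with $a_7^+(n)$ odd. (b) Assume that $14t(6t-1)$ is neither of the form $l(3l-1)$ nor of the form $l(3l+1)$ for any $l\in\mathbb{N}$. Then the interval $[112t-29,\,28t(6t-1)-1]$ contains an integer $n\equiv 3\pmod 4$ with $a_7^+(n)$ even. In particular, $c_7^+(n)$ takes both even and odd values infinitely often for $n$ in the arithmetic progression $n\equiv 3\pmod 4$.
   Context: Let $q=e^{2\pi i z}$ with $z$ in the upper half-plane, and $\eta(z)=q^{1/24}\prod_{n\ge1}(1-q^n)$. Define $f_7^+(z)=\left(\frac{\eta(z)}{\eta(7z)}\right)^{4}=\sum_{n\ge -1}a_7^+(n)q^n$ (so $a_7^+(n)=0$ for $n<-1$). Define $j_7^+(z)=\left(\frac{\eta(z)}{\eta(7z)}\right)^{4}+4+7^2\left(\frac{\eta(7z)}{\eta(z)}\right)^{4}$ and let $c_7^+(n)$ be the coefficient of $q^n$ in its $q$-expansion. *)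

theory Defs
  imports "HOL-Complex_Analysis.Complex_Analysis" "HOL-Number_Theory.Cong"
begin

definition nome :: "complex \<Rightarrow> complex"
  where "nome z = exp (2 * of_real pi * \<i> * z)"

text \<open>
  The Dedekind eta function on the upper half-plane. The factor \<open>q\<^sup>1\<^sup>/\<^sup>2\<^sup>4\<close> means
  \<open>exp (2 \<pi> \<i> z / 24)\<close>; the index of the product is shifted, since it starts at 1.
\<close>
definition dedekind_eta :: "complex \<Rightarrow> complex"
  where "dedekind_eta z =
    exp (2 * of_real pi * \<i> * z / 24) * (\<Prod>n. 1 - nome z ^ (n + 1))"

definition f7_plus :: "complex \<Rightarrow> complex"
  where "f7_plus z = (dedekind_eta z / dedekind_eta (7 * z)) ^ 4"

definition j7_plus :: "complex \<Rightarrow> complex"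
  where "j7_plus z =
    (dedekind_eta z / dedekind_eta (7 * z)) ^ 4 + 4
      + 7 ^ 2 * (dedekind_eta (7 * z) / dedekind_eta z) ^ 4"

text \<open>
  The coefficients are indexed by the integers and vanish below some index. The expansion is
  required to hold on the whole upper half-plane; a function has at most one such expansion.
\<close>
definition has_q_expansion :: "(complex \<Rightarrow> complex) \<Rightarrow> (int \<Rightarrow> complex) \<Rightarrow> bool"
  where "has_q_expansion f a \<longleftrightarrow>
    (\<exists>N. \<forall>n<N. a n = 0) \<and>
    (\<forall>z. Im z > 0 \<longrightarrow> ((\<lambda>n. a n * nome z powi n) has_sum f z) UNIV)"

definition q_coeff :: "(complex \<Rightarrow> complex) \<Rightarrow> int \<Rightarrow> complex"
  where "q_coeff f = (THE a. has_q_expansion f a)"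

definition a7_plus :: "int \<Rightarrow> complex"
  where "a7_plus = q_coeff f7_plus"

definition c7_plus :: "int \<Rightarrow> complex"
  where "c7_plus = q_coeff j7_plus"

text \<open>
  The coefficients are complex numbers by definition, so a parity statement about them
  includes the statement that they are integers.
\<close>
definition odd_integer :: "complex \<Rightarrow> bool"
  where "odd_integer x \<longleftrightarrow> (\<exists>k::int. x = of_int k \<and> odd k)"

definition even_integer :: "complex \<Rightarrow> bool"
  where "even_integer x \<longleftrightarrow> (\<exists>k::int. x = of_int k \<and> even k)"

end

(*
  By Euler's pentagonal number theorem, E(x) = prod (1 - x^n) is, modulo 2, the sum of x^p over the
  generalized pentagonal numbers p. Since E(x)^4 = E(x^4) modulo 2, the series of q f is congruent
  to B(q^4) with B(x) E(x^7) = E(x).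

  For (a), compare coefficients of x^M with M = 7 t (3 t - 1) / 2: the right-hand side vanishes as M
  is not pentagonal, the constant term of B contributes 1 on the left, so another term is odd; the
  gaps between pentagonal numbers bound its index from below.

  For (b), pentagonal numbers are 0, 1, 2 or 5 modulo 7, so the coefficient of x^m in B is even
  whenever m = 3 modulo 7; this gives the witness n = 112 t - 17.

  Adding 4 + 49 / f changes no parity at exponents n = 3 modulo 4, since 1 / f only has odd
  coefficients at n = 1 modulo 4. The hypothesis of (a) holds for all t = 3 modulo 5.
*)
theory Submission
  imports Defs "HOL-Library.Z2"
begin

unbundle no vec_syntax

section \<open>The pentagonal number theorem\<close>

text \<open>Indices k <= 0 give the numbers l (3 l + 1) / 2 with l = -k, so one function covers both
  families in the theorem.\<close>

definition pent :: "int \<Rightarrow> nat"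
  where "pent k = nat (k * (3 * k - 1) div 2)"

lemma two_times_pent: "2 * int (pent k) = k * (3 * k - 1)"
proof -
  have "even (k * (3 * k - 1))" by simp
  moreover have "0 \<le> k * (3 * k - 1)"
  proof (cases "k \<le> 0")
    case True
    then show ?thesis by (intro mult_nonpos_nonpos) auto
  next
    case False
    then show ?thesis by (intro mult_nonneg_nonneg) auto
  qed
  ultimately show ?thesis
    unfolding pent_def by simp
qed

lemma pent_0 [simp]: "pent 0 = 0"
  by (simp add: pent_def)

lemma inj_pent: "inj pent"
proof (rule injI)
  fix k l assume "pent k = pent l"
  then have "k * (3 * k - 1) = l * (3 * l - 1)"
    by (metis two_times_pent)
  then have "(k - l) * (3 * (k + l) - 1) = 0"
    by (simp add: algebra_simps)
  moreover have "3 * (k + l) - 1 \<noteq> 0" by presburger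
  ultimately show "k = l" by simp
qed

text \<open>In increasing order of value the indices run 0, 1, -1, 2, -2, ..., so a cut at
  \<open>pent (- int n)\<close> keeps exactly a symmetric window of indices.\<close>

lemma pent_le_iff: "pent k \<le> pent (- int n) \<longleftrightarrow> \<bar>k\<bar> \<le> int n"
proof -
  have eq: "2 * int (pent (- int n)) = int n * (3 * int n + 1)"
    by (simp add: two_times_pent algebra_simps)
  have "k * (3 * k - 1) \<le> int n * (3 * int n + 1)" if "\<bar>k\<bar> \<le> int n"
  proof -
    have "k * (3 * k - 1) \<le> \<bar>k\<bar> * (3 * \<bar>k\<bar> + 1)"
      by (simp add: abs_if algebra_simps)
    also have "\<dots> \<le> int n * (3 * int n + 1)"
      using that by (intro mult_mono) auto
    finally show ?thesis .
  qed
  moreover have "int n * (3 * int n + 1) < k * (3 * k - 1)" if "\<bar>k\<bar> > int n"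
  proof -
    have "int n * (3 * int n + 1) < (int n + 1) * (3 * (int n + 1) - 1)"
      by (simp add: algebra_simps)
    also have "\<dots> \<le> \<bar>k\<bar> * (3 * \<bar>k\<bar> - 1)"
      using that by (intro mult_mono) auto
    also have "\<dots> \<le> k * (3 * k - 1)"
      by (simp add: abs_if algebra_simps)
    finally show ?thesis .
  qed
  ultimately show ?thesis
    using two_times_pent[of k] eq by linarith
qed

lemma pent_mod_7: "pent k mod 7 \<in> {0, 1, 2, 5}"
proof -
  define r where "r = k mod 7"
  \<comment> \<open>Since 8 = 1 modulo 7, multiplying by 8 clears the denominator 2 without changing
    the residue.\<close>
  have "8 * int (pent k) = 4 * (2 * int (pent k))" by simp
  then have "8 * int (pent k) = 4 * k * (3 * k - 1)"
    by (simp only: two_times_pent mult.assoc)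
  then have "(8 * int (pent k)) mod 7 = (4 * k * (3 * k - 1)) mod 7"
    by (rule arg_cong)
  moreover have "[4 * k * (3 * k - 1) = 4 * r * (3 * r - 1)] (mod 7)"
    unfolding r_def by (intro cong_mult cong_diff) (simp_all add: cong_def)
  ultimately have 8: "(8 * int (pent k)) mod 7 = (4 * r * (3 * r - 1)) mod 7"
    by (simp only: cong_def)
  have "0 \<le> r" "r < 7" unfolding r_def by simp_all
  then have "r = 0 \<or> r = 1 \<or> r = 2 \<or> r = 3 \<or> r = 4 \<or> r = 5 \<or> r = 6" by linarith
  then have *: "(4 * r * (3 * r - 1)) mod 7 \<in> {0, 1, 2, 5}"
    by (elim disjE) simp_all
  have "int (pent k mod 7) = (int (pent k) + 7 * int (pent k)) mod 7"
    unfolding mod_mult_self2 by (simp only: of_nat_mod of_nat_numeral)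
  also have "int (pent k) + 7 * int (pent k) = 8 * int (pent k)" by simp
  finally have "int (pent k mod 7) \<in> {0, 1, 2, 5}"
    using * unfolding 8 by simp
  then show ?thesis by auto
qed

text \<open>Shanks' finite form of the pentagonal number theorem; the difference in \<open>n\<close> of the left-hand
  side telescopes in \<open>s\<close>.\<close>
lemma Shanks_identity:
  fixes q :: "'a :: comm_ring_1"
  shows "(\<Sum>s\<le>n. (-1) ^ s * (\<Prod>k\<in>{s<..n}. 1 - q ^ k) * q ^ (s * n + s * (s + 1) div 2)) =
    (\<Sum>k\<in>{- int n..int n}. (-1) ^ nat \<bar>k\<bar> * q ^ pent k)"
    (is "?S n = ?F n")
proof (induction n)
  case 0
  then show ?case by simp
next
  case (Suc n)
  define e where "e s = s * n + s * (s + 1) div 2" for s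
  \<comment> \<open>\<open>V 0\<close> vanishes through its factor 1 - q^0; \<open>V (Suc n)\<close>
    has an empty product and supplies the index n + 1. The new summand s = n + 1 supplies the index
    -(n + 1).\<close>
  define V where "V s = (-1) ^ s * (\<Prod>k\<in>{s..n}. 1 - q ^ k) * q ^ e s" for s
  have e_Suc: "e (Suc s) = e s + (n + 1 + s)" for s
    unfolding e_def by simp
  have step: "(-1) ^ s * (\<Prod>k\<in>{s<..Suc n}. 1 - q ^ k) * q ^ (s * Suc n + s * (s + 1) div 2) =
      (-1) ^ s * (\<Prod>k\<in>{s<..n}. 1 - q ^ k) * q ^ (s * n + s * (s + 1) div 2) + (V (Suc s) - V s)"
    if "s \<le> n" for s
  proof -
    define p where "p = (\<Prod>k\<in>{s<..n}. 1 - q ^ k)"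
    have "{s<..Suc n} = insert (Suc n) {s<..n}" "{s..n} = insert s {s<..n}"
      and s: "{Suc s..n} = {s<..n}"
      using that by auto
    then have p1: "(\<Prod>k\<in>{s<..Suc n}. 1 - q ^ k) = (1 - q ^ Suc n) * p"
      and p2: "(\<Prod>k\<in>{s..n}. 1 - q ^ k) = (1 - q ^ s) * p"
      by (simp_all add: p_def)
    have e1: "s * Suc n + s * (s + 1) div 2 = e s + s"
      by (simp add: e_def)
    show ?thesis
      unfolding V_def e_Suc s p1 p2 e1 p_def[symmetric] e_def[symmetric]
      by (simp add: algebra_simps power_add)
  qed
  define r where "r = Suc n * (Suc n + 1) div 2"
  have "2 * r = Suc n * (Suc n + 1)" unfolding r_def by simp
  then have r: "2 * int r = int (Suc n) * (int (Suc n) + 1)"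
    by (metis of_nat_1 of_nat_add of_nat_mult of_nat_numeral)
  have V0: "V 0 = 0"
    by (simp add: V_def prod.atLeast_Suc_atMost)
  have "?S (Suc n) = (\<Sum>s\<le>n. (-1) ^ s * (\<Prod>k\<in>{s<..Suc n}. 1 - q ^ k) * q ^ (s * Suc n + s * (s + 1) div 2))
      + (-1) ^ Suc n * q ^ (Suc n * Suc n + Suc n * (Suc n + 1) div 2)"
    by simp
  also have "(\<Sum>s\<le>n. (-1) ^ s * (\<Prod>k\<in>{s<..Suc n}. 1 - q ^ k) * q ^ (s * Suc n + s * (s + 1) div 2)) =
      ?S n + (\<Sum>s\<le>n. V (Suc s) - V s)"
    unfolding sum.distrib[symmetric] by (intro sum.cong refl step) simp
  also have "(\<Sum>s\<le>n. V (Suc s) - V s) = V (Suc n)"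
    using sum_lessThan_telescope[of V "Suc n"] V0 by (simp add: lessThan_Suc_atMost)
  also have "V (Suc n) = (-1) ^ Suc n * q ^ pent (int (Suc n))"
  proof -
    have "2 * int (e (Suc n)) = 2 * int (pent (int (Suc n)))"
      unfolding two_times_pent e_def of_nat_add r_def[symmetric] using r by (simp add: algebra_simps)
    then have "e (Suc n) = pent (int (Suc n))" by linarith
    then show ?thesis by (simp add: V_def)
  qed
  also have "Suc n * Suc n + Suc n * (Suc n + 1) div 2 = pent (- int (Suc n))"
  proof -
    have "2 * int (Suc n * Suc n + Suc n * (Suc n + 1) div 2) = 2 * int (pent (- int (Suc n)))"
      unfolding two_times_pent of_nat_add r_def[symmetric] using r by (simp add: algebra_simps)
    then show ?thesis by (metis mult_cancel_left of_nat_eq_iff zero_neq_numeral)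
  qed
  also have "?S n + (-1) ^ Suc n * q ^ pent (int (Suc n)) + (-1) ^ Suc n * q ^ pent (- int (Suc n)) =
      ?F (Suc n)"
  proof -
    have "{- int (Suc n)..int (Suc n)} = insert (int (Suc n)) (insert (- int (Suc n)) {- int n..int n})"
      by auto
    then have "?F (Suc n) = (-1) ^ nat \<bar>int (Suc n)\<bar> * q ^ pent (int (Suc n)) +
        ((-1) ^ nat \<bar>- int (Suc n)\<bar> * q ^ pent (- int (Suc n)) + ?F n)"
      by (simp only:) (subst sum.insert, simp, simp, subst sum.insert, simp, simp, rule refl)
    also have "nat \<bar>int (Suc n)\<bar> = Suc n" by (simp only: abs_of_nat nat_int)
    also have "nat \<bar>- int (Suc n)\<bar> = Suc n" by (simp only: abs_minus_cancel abs_of_nat nat_int)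
    finally show ?thesis
      by (simp only: Suc.IH add_ac)
  qed
  finally show ?case .
qed

text \<open>Injectivity of \<open>pent\<close> makes \<open>inv pent\<close> recover the index that
  determines the sign. Integer coefficients allow both complex evaluation and reduction modulo
  2.\<close>

definition euler_fps :: "int fps"
  where "euler_fps = Abs_fps (\<lambda>m. if m \<in> range pent then (-1) ^ nat \<bar>inv pent m\<bar> else 0)"

lemma euler_fps_partial_sum:
  fixes q :: "'a :: comm_ring_1"
  shows "(\<Sum>m\<le>pent (- int n). of_int (euler_fps $ m) * q ^ m) =
    (\<Sum>k\<in>{- int n..int n}. (-1) ^ nat \<bar>k\<bar> * q ^ pent k)"
proof -
  have "(\<Sum>m\<le>pent (- int n). of_int (euler_fps $ m) * q ^ m) =
      (\<Sum>m\<in>pent ` {- int n..int n}. of_int (euler_fps $ m) * q ^ m)"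
  proof (rule sum.mono_neutral_right)
    have in_image: "pent k \<in> pent ` {- int n..int n}" if "\<bar>k\<bar> \<le> int n" for k
      using that by (intro imageI) auto
    show "pent ` {- int n..int n} \<subseteq> {..pent (- int n)}"
      by (auto simp: pent_le_iff)
    show "\<forall>m\<in>{..pent (- int n)} - pent ` {- int n..int n}. of_int (euler_fps $ m) * q ^ m = 0"
      using in_image by (auto simp: euler_fps_def pent_le_iff)
  qed auto
  also have "\<dots> = (\<Sum>k\<in>{- int n..int n}. of_int (euler_fps $ pent k) * q ^ pent k)"
    by (subst sum.reindex) (auto intro: inj_on_subset[OF inj_pent])
  also have "\<dots> = (\<Sum>k\<in>{- int n..int n}. (-1) ^ nat \<bar>k\<bar> * q ^ pent k)"
    by (intro sum.cong) (auto simp: euler_fps_def inv_f_f[OF inj_pent])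
  finally show ?thesis .
qed

section \<open>Convergence of the pentagonal series to Euler's product\<close>

definition euler_fun :: "complex \<Rightarrow> complex"
  where "euler_fun q = (\<Prod>n. 1 - q ^ (n + 1))"

lemma
  fixes q :: complex
  assumes "norm q < 1"
  shows convergent_prod_euler: "convergent_prod (\<lambda>n. 1 - q ^ (n + 1))"
    and euler_fun_nonzero: "euler_fun q \<noteq> 0"
proof -
  have "summable (\<lambda>n. norm (1 - q ^ (n + 1) - 1))"
    using assms by (simp add: norm_mult norm_power summable_geometric)
  then show *: "convergent_prod (\<lambda>n. 1 - q ^ (n + 1))"
    by (intro abs_convergent_prod_imp_convergent_prod summable_imp_abs_convergent_prod)
  have "q ^ (n + 1) \<noteq> 1" for n
    using assms power_less_one_iff[of "norm q" "n + 1"]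
    by (metis add_gr_0 less_irrefl norm_ge_zero norm_one norm_power zero_less_one)
  then show "euler_fun q \<noteq> 0"
    unfolding euler_fun_def by (intro prodinf_nonzero[OF *]) auto
qed

text \<open>Combines 1 + x <= exp x with the geometric series. Uniformity in s and n is what the
  limit of Shanks' identity requires.\<close>

lemma norm_euler_partial_prod_le:
  fixes q :: complex
  assumes "norm q < 1"
  shows "norm (\<Prod>k\<in>{s<..n}. 1 - q ^ k) \<le> exp (1 / (1 - norm q))"
proof -
  have "norm (\<Prod>k\<in>{s<..n}. 1 - q ^ k) = (\<Prod>k\<in>{s<..n}. norm (1 - q ^ k))"
    by (rule prod_norm[symmetric])
  also have "\<dots> \<le> (\<Prod>k\<in>{s<..n}. exp (norm q ^ k))"
  proof (intro prod_mono conjI norm_ge_zero)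
    fix k
    have "norm (1 - q ^ k) \<le> 1 + norm q ^ k"
      by (metis norm_one norm_power norm_triangle_ineq4)
    also have "\<dots> \<le> exp (norm q ^ k)"
      by (rule exp_ge_add_one_self)
    finally show "norm (1 - q ^ k) \<le> exp (norm q ^ k)" .
  qed
  also have "\<dots> = exp (\<Sum>k\<in>{s<..n}. norm q ^ k)"
    by (simp add: exp_sum)
  also have "(\<Sum>k\<in>{s<..n}. norm q ^ k) \<le> (\<Sum>k. norm q ^ k)"
    using assms by (intro sum_le_suminf) (auto intro: summable_geometric)
  also have "(\<Sum>k. norm q ^ k) = 1 / (1 - norm q)"
    using assms by (intro suminf_geometric) simp
  finally show ?thesis by simp
qed

text \<open>Let n tend to infinity in Shanks' identity: the term s = 0 tends to the product, and the
  other terms together are at most a constant times n |q|^n.\<close>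

theorem pentagonal_number_theorem:
  fixes q :: complex
  assumes "norm q < 1"
  shows "(\<lambda>m. of_int (euler_fps $ m) * q ^ m) sums euler_fun q"
proof -
  define t where "t n s = (-1) ^ s * (\<Prod>k\<in>{s<..n}. 1 - q ^ k) * q ^ (s * n + s * (s + 1) div 2)"
    for n s :: nat
  define C where "C = exp (1 / (1 - norm q))"
  have t0: "(\<lambda>n. t (Suc n) 0) \<longlonglongrightarrow> euler_fun q"
  proof -
    have "t (Suc n) 0 = (\<Prod>k\<le>n. 1 - q ^ (k + 1))" for n
    proof -
      have "{0<..Suc n} = Suc ` {..n}"
        by (auto simp: image_iff Suc_le_eq gr0_conv_Suc)
      then show ?thesis by (simp add: t_def prod.reindex)
    qed
    then show ?thesis
      using convergent_prod_LIMSEQ[OF convergent_prod_euler[OF assms]] by (simp add: euler_fun_def)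
  qed
  have rest: "(\<lambda>n. \<Sum>s\<in>{1..Suc n}. t (Suc n) s) \<longlonglongrightarrow> 0"
  proof (rule Lim_null_comparison)
    have "norm (\<Sum>s\<in>{1..Suc n}. t (Suc n) s) \<le> real (Suc n) * (C * norm q ^ Suc n)" for n
    proof -
      have "norm (t (Suc n) s) \<le> C * norm q ^ Suc n" if "s \<in> {1..Suc n}" for s
      proof -
        have "Suc n \<le> s * Suc n + s * (s + 1) div 2"
          using that mult_le_mono1[of 1 s "Suc n"] by (intro trans_le_add1) simp
        then have "norm q ^ (s * Suc n + s * (s + 1) div 2) \<le> norm q ^ Suc n"
          using assms by (intro power_decreasing) auto
        then show ?thesis
          using norm_euler_partial_prod_le[OF assms, of s "Suc n"]
          unfolding t_def C_def norm_mult norm_power by (auto intro!: mult_mono)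
      qed
      then show ?thesis
        using sum_norm_bound[of "{1..Suc n}" "t (Suc n)" "C * norm q ^ Suc n"] by simp
    qed
    then show "\<forall>\<^sub>F n in sequentially.
        norm (\<Sum>s\<in>{1..Suc n}. t (Suc n) s) \<le> C * (real (Suc n) * norm q ^ Suc n)"
      by (simp add: mult_ac)
    have "(\<lambda>n. real n * norm q ^ n) \<longlonglongrightarrow> 0"
      using assms by (intro powser_times_n_limit_0) simp
    then show "(\<lambda>n. C * (real (Suc n) * norm q ^ Suc n)) \<longlonglongrightarrow> 0"
      by (intro tendsto_mult_right_zero LIMSEQ_Suc)
  qed
  have eq: "(\<Sum>m\<le>pent (- int (Suc n)). of_int (euler_fps $ m) * q ^ m) =
      t (Suc n) 0 + (\<Sum>s\<in>{1..Suc n}. t (Suc n) s)" for n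
    unfolding euler_fps_partial_sum Shanks_identity[symmetric] t_def[symmetric]
    by (simp add: atMost_atLeast0 sum.atLeast_Suc_atMost)
  \<comment> \<open>Shanks' identity reaches only the partial sums ending at some
    \<open>pent (- int (Suc n))\<close>. Coefficients bounded by 1 give convergence, so this
    subsequence determines the sum.\<close>
  have "summable (\<lambda>m. of_int (euler_fps $ m) * q ^ m)"
  proof (rule summable_comparison_test)
    show "\<exists>N. \<forall>m\<ge>N. norm (of_int (euler_fps $ m) * q ^ m) \<le> norm q ^ m"
      by (auto simp: euler_fps_def norm_mult norm_power)
    show "summable (\<lambda>m. norm q ^ m)"
      using assms by (intro summable_geometric) simp
  qed
  then obtain l where l: "(\<lambda>m. of_int (euler_fps $ m) * q ^ m) sums l"
    by (auto simp: summable_def)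
  have "strict_mono (\<lambda>n. pent (- int (Suc n)))"
    by (rule strict_monoI) (simp only: not_le[symmetric] pent_le_iff abs_minus_cancel abs_of_nat
        of_nat_le_iff Suc_le_mono not_False_eq_True)
  with l have "(\<lambda>n. \<Sum>m\<le>pent (- int (Suc n)). of_int (euler_fps $ m) * q ^ m) \<longlonglongrightarrow> l"
    unfolding sums_def_le using LIMSEQ_subseq_LIMSEQ by (fastforce simp: o_def)
  moreover have "(\<lambda>n. \<Sum>m\<le>pent (- int (Suc n)). of_int (euler_fps $ m) * q ^ m) \<longlonglongrightarrow> euler_fun q + 0"
    unfolding eq by (intro tendsto_add t0 rest)
  ultimately have "l = euler_fun q"
    using LIMSEQ_unique by fastforce
  with l show ?thesis by simp
qed

section \<open>Integer power series on the unit disc\<close>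

text \<open>The target ring is left open: complex numbers for the analysis, \<open>bit\<close> for
  parity.\<close>

definition fps_of_ints :: "int fps \<Rightarrow> 'a :: comm_ring_1 fps"
  where "fps_of_ints F = Abs_fps (\<lambda>n. of_int (F $ n))"

lemma fps_of_ints_nth [simp]: "fps_of_ints F $ n = of_int (F $ n)"
  by (simp add: fps_of_ints_def)

lemma fps_of_ints_mult: "fps_of_ints (F * G) = fps_of_ints F * fps_of_ints G"
  by (simp add: fps_eq_iff fps_mult_nth)

text \<open>For d > 0 this is the substitution F(x^d).\<close>

definition fps_dilate :: "nat \<Rightarrow> 'a :: zero fps \<Rightarrow> 'a fps"
  where "fps_dilate d F = Abs_fps (\<lambda>n. if d dvd n then F $ (n div d) else 0)"

lemma fps_dilate_nth: "fps_dilate d F $ n = (if d dvd n then F $ (n div d) else 0)"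
  by (simp add: fps_dilate_def)

lemma fps_dilate_nth_0 [simp]: "fps_dilate d F $ 0 = F $ 0"
  by (simp add: fps_dilate_nth)

lemma fps_of_ints_dilate: "fps_of_ints (fps_dilate d F) = fps_dilate d (fps_of_ints F)"
  by (simp add: fps_eq_iff fps_dilate_nth)

lemma fps_dilate_dilate: "fps_dilate d (fps_dilate e F) = fps_dilate (d * e) F"
  by (cases "d = 0")
    (auto simp: fps_eq_iff fps_dilate_nth div_mult2_eq elim!: dvdE)

text \<open>The whole disc is needed because a q-expansion must hold on the entire upper half-plane,
  whose nomes fill the punctured disc.\<close>

definition disc_expansion :: "(complex \<Rightarrow> complex) \<Rightarrow> int fps \<Rightarrow> bool"
  where "disc_expansion f F \<longleftrightarrow> (\<forall>q. norm q < 1 \<longrightarrow> (\<lambda>n. of_int (F $ n) * q ^ n) sums f q)"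

lemma disc_expansion_summable_norm:
  fixes q :: complex
  assumes "disc_expansion f F" "norm q < 1"
  shows "summable (\<lambda>n. norm (of_int (F $ n) * q ^ n))"
proof -
  \<comment> \<open>A point of the disc farther from 0 than q: convergence there gives absolute
    convergence at q.\<close>
  define x :: complex where "x = of_real ((1 + norm q) / 2)"
  have x: "norm x = (1 + norm q) / 2"
    by (simp only: x_def norm_of_real) (simp add: abs_of_nonneg)
  have less: "norm q < norm x" using assms by (simp add: x)
  have "norm x < 1" using assms by (simp add: x)
  then have "summable (\<lambda>n. of_int (F $ n) * x ^ n)"
    using assms(1) by (auto simp: disc_expansion_def sums_iff)
  then show ?thesis
    using less by (rule powser_insidea)
qed

lemma disc_expansion_has_fps_expansion:
  assumes "disc_expansion f F"
  shows "f has_fps_expansion fps_of_ints F"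
proof (rule has_fps_expansionI)
  have "\<forall>\<^sub>F u in nhds 0. u \<in> ball (0 :: complex) 1"
    by (intro eventually_nhds_in_open) auto
  then show "\<forall>\<^sub>F u in nhds 0. (\<lambda>n. fps_of_ints F $ n * u ^ n) sums f u"
    by eventually_elim (use assms in \<open>auto simp: disc_expansion_def\<close>)
qed

lemma disc_expansion_holomorphic:
  assumes "disc_expansion f F"
  shows "f holomorphic_on ball 0 1"
  by (rule power_series_holomorphic[where a = "\<lambda>n. of_int (F $ n)"])
    (use assms in \<open>auto simp: disc_expansion_def\<close>)

lemma disc_expansion_mult:
  assumes "disc_expansion f F" "disc_expansion g G"
  shows "disc_expansion (\<lambda>q. f q * g q) (F * G)"
  unfolding disc_expansion_def
proof (intro allI impI)
  fix q :: complex assume q: "norm q < 1"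
  have "(\<lambda>k. \<Sum>i\<le>k. (of_int (F $ i) * q ^ i) * (of_int (G $ (k - i)) * q ^ (k - i))) sums
      ((\<Sum>n. of_int (F $ n) * q ^ n) * (\<Sum>n. of_int (G $ n) * q ^ n))"
    using assms q by (intro Cauchy_product_sums disc_expansion_summable_norm)
  moreover have "(\<Sum>i\<le>k. (of_int (F $ i) * q ^ i) * (of_int (G $ (k - i)) * q ^ (k - i))) =
      of_int ((F * G) $ k) * q ^ k" for k
  proof -
    have "(of_int (F $ i) * q ^ i) * (of_int (G $ (k - i)) * q ^ (k - i)) =
        of_int (F $ i * G $ (k - i)) * q ^ k" if "i \<le> k" for i
      using that by (simp add: mult_ac flip: power_add)
    then have "(\<Sum>i\<le>k. (of_int (F $ i) * q ^ i) * (of_int (G $ (k - i)) * q ^ (k - i))) =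
        (\<Sum>i\<le>k. of_int (F $ i * G $ (k - i)) * q ^ k)"
      by (intro sum.cong) auto
    then show ?thesis
      by (simp add: fps_mult_nth sum_distrib_right atMost_atLeast0)
  qed
  moreover have "(\<Sum>n. of_int (F $ n) * q ^ n) = f q" "(\<Sum>n. of_int (G $ n) * q ^ n) = g q"
    using assms q by (auto simp: disc_expansion_def sums_iff)
  ultimately show "(\<lambda>n. of_int ((F * G) $ n) * q ^ n) sums (f q * g q)"
    by simp
qed

lemma disc_expansion_power:
  assumes "disc_expansion f F"
  shows "disc_expansion (\<lambda>q. f q ^ n) (F ^ n)"
proof (induction n)
  case 0
  have "of_int (1 $ n) * q ^ n = (if n = 0 then 1 else 0) * q ^ n" for q :: complex and n
    by simp
  then show ?case
    using powser_sums_if[of 0, where ?'a = complex] by (simp only: disc_expansion_def power_0) simp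
next
  case (Suc n)
  then show ?case using disc_expansion_mult[OF assms Suc.IH] by simp
qed

lemma disc_expansion_dilate:
  assumes "disc_expansion f F" "d > 0"
  shows "disc_expansion (\<lambda>q. f (q ^ d)) (fps_dilate d F)"
  unfolding disc_expansion_def
proof (intro allI impI)
  fix q :: complex assume "norm q < 1"
  then have "norm (q ^ d) < 1"
    using assms(2) by (simp add: norm_power power_less_one_iff)
  then have "(\<lambda>n. of_int (F $ n) * (q ^ d) ^ n) sums f (q ^ d)"
    using assms(1) by (simp add: disc_expansion_def)
  moreover have "of_int (F $ n) * (q ^ d) ^ n = of_int (fps_dilate d F $ (d * n)) * q ^ (d * n)" for n
    using assms(2) by (simp add: fps_dilate_nth power_mult)
  ultimately have "(\<lambda>n. of_int (fps_dilate d F $ (d * n)) * q ^ (d * n)) sums f (q ^ d)"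
    by simp
  then show "(\<lambda>n. of_int (fps_dilate d F $ n) * q ^ n) sums f (q ^ d)"
    by (subst (asm) sums_mono_reindex)
      (use assms(2) in \<open>auto simp: strict_mono_def fps_dilate_nth elim!: dvdE\<close>)
qed

text \<open>The formal quotient has integer coefficients; it converges on the whole disc since it is the
  Taylor series of the holomorphic quotient.\<close>
lemma disc_expansion_divide:
  assumes f: "disc_expansion f F" and g: "disc_expansion g G" and "G $ 0 = 1"
    and nz: "\<And>q. norm q < 1 \<Longrightarrow> g q \<noteq> 0"
  obtains H where "H * G = F" "disc_expansion (\<lambda>q. f q / g q) H"
proof
  \<comment> \<open>The constant term 1 makes \<open>G\<close> invertible over the integers.\<close>
  define H where "H = F * fps_right_inverse G 1"
  have "G * fps_right_inverse G 1 = 1"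
    using assms by (intro fps_right_inverse) simp
  then show HG: "H * G = F"
    by (simp add: H_def mult_ac)
  define h where "h = (\<lambda>q. f q / g q)"
  have holo: "h holomorphic_on ball 0 1"
    unfolding h_def using nz
    by (intro holomorphic_intros disc_expansion_holomorphic[OF f] disc_expansion_holomorphic[OF g]) auto
  define E where "E = fps_expansion h 0"
  have "h has_fps_expansion E"
    unfolding E_def by (rule has_fps_expansion_fps_expansion[OF _ _ holo]) auto
  then have hg: "(\<lambda>q. h q * g q) has_fps_expansion E * fps_of_ints G"
    by (intro has_fps_expansion_mult disc_expansion_has_fps_expansion g)
  have "\<forall>\<^sub>F q in nhds 0. h q * g q = f q"
  proof -
    have "\<forall>\<^sub>F u in nhds 0. u \<in> ball (0 :: complex) 1"
      by (intro eventually_nhds_in_open) auto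
    then show ?thesis
      by eventually_elim (simp add: h_def nz)
  qed
  then have "f has_fps_expansion E * fps_of_ints G"
    by (rule has_fps_expansion_cong[OF _ refl, THEN iffD1, OF _ hg])
  then have "E * fps_of_ints G = fps_of_ints F"
    using fps_expansion_unique_complex disc_expansion_has_fps_expansion[OF f] by blast
  also have "\<dots> = fps_of_ints H * fps_of_ints G"
    by (simp add: HG flip: fps_of_ints_mult)
  finally have "E * fps_of_ints G = fps_of_ints H * fps_of_ints G" .
  \<comment> \<open>Complex power series form an integral domain, so a nonzero factor cancels and
    the Taylor series \<open>E\<close> is the integral quotient.\<close>
  moreover have "fps_of_ints G $ 0 \<noteq> (0 :: complex)"
    using \<open>G $ 0 = 1\<close> by simp
  then have "fps_of_ints G \<noteq> (0 :: complex fps)" by (metis fps_zero_nth)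
  ultimately have EH: "E = fps_of_ints H" by simp
  show "disc_expansion (\<lambda>q. f q / g q) H"
    unfolding disc_expansion_def
  proof (intro allI impI)
    fix q :: complex assume "norm q < 1"
    then have "(\<lambda>n. (deriv ^^ n) h 0 / fact n * (q - 0) ^ n) sums h q"
      by (intro holomorphic_power_series[OF holo]) simp
    moreover have "(deriv ^^ n) h 0 / fact n = of_int (H $ n)" for n
      using arg_cong[OF EH, of "\<lambda>F. F $ n"] by (simp add: E_def fps_expansion_def)
    ultimately show "(\<lambda>n. of_int (H $ n) * q ^ n) sums (f q / g q)"
      by (simp only: diff_zero) (simp only: h_def)
  qed
qed

lemma disc_expansion_euler: "disc_expansion euler_fun euler_fps"
  by (simp add: disc_expansion_def pentagonal_number_theorem)

section \<open>Uniqueness of q-expansions\<close>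

lemma norm_nome_less_1: "Im z > 0 \<Longrightarrow> norm (nome z) < 1"
  by (simp add: nome_def)

text \<open>Turns identities on the half-plane into identities on the punctured disc; the principal
  logarithm suffices, as its real part is ln |q| < 0.\<close>

lemma nome_surj:
  assumes "q \<noteq> 0" "norm q < 1"
  obtains z where "Im z > 0" "nome z = q"
proof
  define z where "z = Ln q / (2 * of_real pi * \<i>)"
  have *: "2 * of_real pi * \<i> * z = Ln q"
    by (simp add: z_def)
  then show "nome z = q"
    using assms by (simp add: nome_def *)
  have "- (2 * pi * Im z) = Re (Ln q)"
    by (simp flip: *)
  also have "\<dots> < 0" using assms by simp
  finally show "Im z > 0" by (simp add: zero_less_mult_iff)
qed

text \<open>Factoring out q^M turns a Laurent series with finitely many negative exponents into a
  power series. Both uniqueness and existence of q-expansions rest on this.\<close>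

lemma has_sum_shift_int:
  fixes q :: complex
  assumes "q \<noteq> 0" "\<And>n. n < M \<Longrightarrow> d n = 0"
  shows "((\<lambda>n. d n * q powi n) has_sum (q powi M * s)) UNIV \<longleftrightarrow>
    ((\<lambda>n. d (int n + M) * q ^ n) has_sum s) UNIV"
proof -
  have "((\<lambda>n. d n * q powi n) has_sum (q powi M * s)) UNIV \<longleftrightarrow>
      ((\<lambda>n. d n * q powi n) has_sum (q powi M * s)) (range (\<lambda>n. int n + M))"
  proof (rule has_sum_cong_neutral)
    fix n assume "n \<in> UNIV - range (\<lambda>n. int n + M)"
    moreover have "n = int (nat (n - M)) + M" if "n \<ge> M" using that by simp
    ultimately have "n < M" by (metis DiffD2 not_le rangeI)
    then show "d n * q powi n = 0" using assms by simp
  qed auto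
  also have "\<dots> \<longleftrightarrow> ((\<lambda>n. q powi M * (d (int n + M) * q ^ n)) has_sum (q powi M * s)) UNIV"
    by (subst has_sum_reindex) (auto simp: inj_on_def o_def power_int_add assms mult_ac)
  also have "\<dots> \<longleftrightarrow> ((\<lambda>n. d (int n + M) * q ^ n) has_sum s) UNIV"
    using assms by (subst has_sum_cmult_right_iff) auto
  finally show ?thesis .
qed

text \<open>The difference of two expansions shifts to a power series that sums to 0 on the disc, so
  its coefficients vanish.\<close>

lemma has_q_expansion_unique:
  assumes "has_q_expansion f a" "has_q_expansion f a'"
  shows "a = a'"
proof -
  obtain N N' where N: "\<And>n. n < N \<Longrightarrow> a n = 0" "\<And>n. n < N' \<Longrightarrow> a' n = 0"
    using assms by (auto simp: has_q_expansion_def)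
  \<comment> \<open>One less than the minimum, so that the shifted series also sums to \<open>0\<close> at \<open>q = 0\<close>.\<close>
  define M where "M = min N N' - 1"
  define d where "d n = a n - a' n" for n
  have d0: "d n = 0" if "n \<le> M" for n
    using that N by (simp add: d_def M_def)
  have *: "(\<lambda>n. d (int n + M) * q ^ n) sums 0" if q: "norm q < 1" for q
  proof (cases "q = 0")
    case True
    then have "(\<lambda>n. d (int n + M) * q ^ n) = (\<lambda>n. 0)"
      by (auto simp: d0 fun_eq_iff power_0_left)
    then show ?thesis by simp
  next
    case False
    then obtain z where z: "Im z > 0" "nome z = q"
      using q nome_surj by blast
    have "((\<lambda>n. a n * q powi n + - (a' n * q powi n)) has_sum (f z + - f z)) UNIV"
      using assms z by (intro has_sum_add) (auto simp: has_q_expansion_def has_sum_uminus)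
    then have "((\<lambda>n. d n * q powi n) has_sum (q powi M * 0)) UNIV"
      by (simp add: d_def algebra_simps)
    then show ?thesis
      using False d0 by (subst (asm) has_sum_shift_int) (auto intro: has_sum_imp_sums)
  qed
  have "(\<lambda>_. 0) has_fps_expansion Abs_fps (\<lambda>n. d (int n + M))"
  proof (rule has_fps_expansionI)
    have "\<forall>\<^sub>F u in nhds 0. u \<in> ball (0 :: complex) 1"
      by (intro eventually_nhds_in_open) auto
    then show "\<forall>\<^sub>F u in nhds 0. (\<lambda>n. Abs_fps (\<lambda>n. d (int n + M)) $ n * u ^ n) sums 0"
      by eventually_elim (simp add: *)
  qed
  then have "Abs_fps (\<lambda>n. d (int n + M)) = 0"
    by (rule fps_expansion_unique_complex) simp
  then have "d (int n + M) = 0" for n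
    by (simp add: fps_eq_iff)
  then have "d n = 0" for n
    using d0[of n] by (metis add.commute diff_add_cancel linear nat_0_le diff_ge_0_iff_ge)
  then show ?thesis by (auto simp: d_def fun_eq_iff)
qed

lemma q_coeff_eqI: "has_q_expansion f a \<Longrightarrow> q_coeff f = a"
  unfolding q_coeff_def by (rule the_equality) (auto intro: has_q_expansion_unique)

text \<open>The coefficients of q^M F(q).\<close>

definition laurent_coeff :: "int \<Rightarrow> int fps \<Rightarrow> int \<Rightarrow> complex"
  where "laurent_coeff M F n = (if n < M then 0 else of_int (F $ nat (n - M)))"

lemma disc_expansion_has_sum:
  assumes "disc_expansion f F" "q \<noteq> 0" "norm q < 1"
  shows "((\<lambda>n. laurent_coeff M F n * q powi n) has_sum (q powi M * f q)) UNIV"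
proof (subst has_sum_shift_int)
  have "((\<lambda>n. of_int (F $ n) * q ^ n) has_sum f q) UNIV"
    using assms by (intro norm_summable_imp_has_sum disc_expansion_summable_norm)
      (auto simp: disc_expansion_def)
  then show "((\<lambda>n. laurent_coeff M F (int n + M) * q ^ n) has_sum f q) UNIV"
    by (simp add: laurent_coeff_def)
qed (use assms in \<open>auto simp: laurent_coeff_def\<close>)

section \<open>Reduction modulo 2\<close>

lemma of_int_bit_eq_0_iff [simp]: "(of_int x :: bit) = 0 \<longleftrightarrow> even x"
proof (cases "even x")
  case True
  then show ?thesis by (auto elim!: evenE)
next
  case False
  then show ?thesis by (auto elim!: oddE)
qed

lemma fps_of_ints_power: "fps_of_ints (F ^ n) = fps_of_ints F ^ n"
proof (induction n)
  case 0
  show ?case by (simp add: fps_eq_iff)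
next
  case (Suc n)
  then show ?case by (simp add: fps_of_ints_mult)
qed

text \<open>The terms \<open>i\<close> and \<open>n - i\<close> of the convolution cancel.\<close>
lemma bit_fps_square: "F * F = fps_dilate 2 F" for F :: "bit fps"
proof (rule fps_ext)
  fix n
  define h where "h i = F $ i * F $ (n - i)" for i
  have "(F * F) $ n = sum h {0..n}"
    by (simp add: fps_mult_nth h_def)
  also have "{0..n} = {i. 2 * i < n} \<union> ({i. n < 2 * i \<and> i \<le> n} \<union> {i. 2 * i = n})"
    by auto
  also have "sum h \<dots> = sum h {i. 2 * i < n} + (sum h {i. n < 2 * i \<and> i \<le> n} + sum h {i. 2 * i = n})"
    by (subst sum.union_disjoint; (subst sum.union_disjoint)?)
      (auto intro: finite_subset[of _ "{..n}"])
  also have "sum h {i. n < 2 * i \<and> i \<le> n} = sum h {i. 2 * i < n}"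
    by (rule sum.reindex_bij_witness[of _ "\<lambda>i. n - i" "\<lambda>i. n - i"]) (auto simp: h_def mult.commute)
  \<comment> \<open>Only the middle term survives, and squaring is the identity on
    \<open>bit\<close>.\<close>
  also have "sum h {i. 2 * i = n} = fps_dilate 2 F $ n"
  proof (cases "even n")
    case True
    then have "{i. 2 * i = n} = {n div 2}" "n - n div 2 = n div 2" by auto
    then show ?thesis using True by (simp add: h_def fps_dilate_nth)
  next
    case False
    then have "{i. 2 * i = n} = {}" by auto
    then show ?thesis using False by (simp add: fps_dilate_nth)
  qed
  finally have "(F * F) $ n =
      (sum h {i. 2 * i < n} + sum h {i. 2 * i < n}) + fps_dilate 2 F $ n"
    by (simp only: add.assoc)
  also have "sum h {i. 2 * i < n} + sum h {i. 2 * i < n} = 0"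
    by (metis bit_2_eq_0 mult_2 mult_zero_left)
  finally show "(F * F) $ n = fps_dilate 2 F $ n"
    by (simp only: add_0)
qed

lemma bit_fps_power4: "F ^ 4 = fps_dilate 4 F" for F :: "bit fps"
proof -
  have "F ^ 4 = (F * F) * (F * F)"
    by (simp add: power4_eq_xxxx mult_ac)
  then show ?thesis
    by (simp add: bit_fps_square fps_dilate_dilate)
qed

section \<open>Euler's series modulo 2 and quotients of its dilates\<close>

definition euler_bit :: "bit fps"
  where "euler_bit = fps_of_ints euler_fps"

lemma euler_bit_nth: "euler_bit $ m = of_bool (m \<in> range pent)"
  by (simp add: euler_bit_def euler_fps_def)

lemma euler_bit_nth_0 [simp]: "euler_bit $ 0 = 1"
  using rangeI[of pent 0] by (simp add: euler_bit_nth)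

lemma euler_fps_nth_0 [simp]: "euler_fps $ 0 = 1"
proof -
  have "0 \<in> range pent" "inv pent 0 = 0"
    using inv_f_f[OF inj_pent, of 0] rangeI[of pent 0] by simp_all
  then show ?thesis by (simp add: euler_fps_def)
qed

text \<open>Used with d = 1 and d = 7: modulo 2 the numerator and denominator of q f become E(x^4)
  and E(x^28).\<close>

lemma fps_of_ints_euler_power4:
  "fps_of_ints (fps_dilate d euler_fps ^ 4) = fps_dilate (4 * d) euler_bit"
  by (simp add: fps_of_ints_power bit_fps_power4 fps_of_ints_dilate fps_dilate_dilate euler_bit_def)

text \<open>Strong induction on n: \<open>S\<close> is closed under subtracting exponents of
  \<open>C\<close>, so each earlier coefficient of \<open>B\<close> that enters the n-th convolution
  already vanishes.\<close>

lemma quotient_nth_eq_0: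
  fixes B C G :: "'a :: comm_ring_1 fps"
  assumes "B * C = G" "C $ 0 = 1"
    and G: "\<And>n. n \<in> S \<Longrightarrow> G $ n = 0"
    and C: "\<And>n j. n \<in> S \<Longrightarrow> j \<le> n \<Longrightarrow> C $ j \<noteq> 0 \<Longrightarrow> n - j \<in> S"
    and "n \<in> S"
  shows "B $ n = 0"
  using \<open>n \<in> S\<close>
proof (induction n rule: less_induct)
  case (less n)
  have "B $ i * C $ (n - i) = 0" if "i < n" for i
  proof (cases "C $ (n - i) = 0")
    case False
    then have "n - (n - i) \<in> S" using less.prems by (intro C) auto
    then have "B $ i = 0" using that by (intro less.IH) auto
    then show ?thesis by simp
  qed simp
  then have "(B * C) $ n = B $ n * C $ 0"
    by (simp add: fps_mult_nth atLeast0AtMost flip: lessThan_Suc_atMost)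
  then show ?case using assms(1,2) G less.prems by simp
qed

text \<open>The class 12 modulo 28 is four times the class 3 modulo 7. It contains no exponent of
  E(x^4), and subtracting exponents of E(x^28) preserves it.\<close>

lemma quotient_nth_eq_0_mod_7:
  assumes "b * fps_dilate 28 euler_bit = fps_dilate 4 euler_bit" "m mod 7 = 3"
  shows "b $ (4 * m) = 0"
proof (rule quotient_nth_eq_0[OF assms(1), where S = "range (\<lambda>k. 28 * k + 12)"])
  show "fps_dilate 4 euler_bit $ n = 0" if n_in: "n \<in> range (\<lambda>k. 28 * k + 12)" for n
  proof -
    obtain k where "n = 28 * k + 12" using n_in by blast
    then have n: "n = 4 * (7 * k + 3)" by simp
    have "(7 * k + 3) mod 7 = 3" by simp
    then have "7 * k + 3 \<noteq> pent l" for l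
      using pent_mod_7[of l] by force
    then have "7 * k + 3 \<notin> range pent" by blast
    then show ?thesis unfolding n by (simp add: fps_dilate_nth euler_bit_nth)
  qed
  show "n - j \<in> range (\<lambda>k. 28 * k + 12)"
    if n_in: "n \<in> range (\<lambda>k. 28 * k + 12)" and j_le: "j \<le> n"
      and nz: "fps_dilate 28 euler_bit $ j \<noteq> 0" for n j
  proof -
    obtain k where n: "n = 28 * k + 12" using n_in by blast
    have "28 dvd j" using nz by (metis fps_dilate_nth)
    then obtain i where j: "j = 28 * i" by blast
    have "i \<le> k" using j_le unfolding n j by linarith
    then have "n - j = 28 * (k - i) + 12" unfolding n j by (simp add: diff_mult_distrib2)
    then show ?thesis by blast
  qed
  have "m = 7 * (m div 7) + 3"
    using assms(2) mult_div_mod_eq[of 7 m] by simp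
  then have "4 * m = 28 * (m div 7) + 12" by linarith
  then show "4 * m \<in> range (\<lambda>k. 28 * k + 12)" by blast
qed simp

text \<open>Both given series involve only exponents divisible by 4, hence so does the quotient. It
  serves for 1 / f.\<close>

lemma quotient_nth_eq_0_mod_4:
  assumes "d * fps_dilate 4 euler_bit = fps_dilate 28 euler_bit" "\<not> 4 dvd n"
  shows "d $ n = 0"
proof (rule quotient_nth_eq_0[OF assms(1), where S = "{n. \<not> 4 dvd n}"])
  show "fps_dilate 28 euler_bit $ n = 0" if "n \<in> {n. \<not> 4 dvd n}" for n
  proof -
    have "\<not> 28 dvd n" using that dvd_trans[of 4 28 n] by auto
    then show ?thesis by (simp add: fps_dilate_nth)
  qed
  show "n - j \<in> {n. \<not> 4 dvd n}"
    if "n \<in> {n. \<not> 4 dvd n}" "j \<le> n" "fps_dilate 4 euler_bit $ j \<noteq> 0" for n j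
  proof -
    have "4 dvd j" using that(3) by (metis fps_dilate_nth)
    then show ?thesis using that(1,2) dvd_diffD[of 4 n j] by blast
  qed
qed (use assms in auto)

text \<open>The predecessor of \<open>pent t\<close> among pentagonal numbers is
  \<open>pent (1 - t)\<close>, at distance 2 t - 1.\<close>

lemma pent_gap:
  assumes "t > 0" "pent k < pent t"
  shows "int (pent k) + 2 * t - 1 \<le> int (pent t)"
proof -
  have "\<bar>k\<bar> < t"
  proof (rule ccontr)
    assume "\<not> \<bar>k\<bar> < t"
    then have "t * (3 * t - 1) \<le> \<bar>k\<bar> * (3 * \<bar>k\<bar> - 1)"
      using assms(1) by (intro mult_mono) auto
    also have "\<dots> \<le> k * (3 * k - 1)"
      by (simp add: abs_if algebra_simps)
    finally show False
      using assms(2) two_times_pent[of k] two_times_pent[of t] by linarith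
  qed
  have "k * (3 * k - 1) \<le> \<bar>k\<bar> * (3 * \<bar>k\<bar> + 1)"
    by (simp add: abs_if algebra_simps)
  also have "\<dots> \<le> (t - 1) * (3 * (t - 1) + 1)"
    using \<open>\<bar>k\<bar> < t\<close> by (intro mult_mono) auto
  also have "\<dots> = t * (3 * t - 1) - (4 * t - 2)"
    by (simp add: algebra_simps)
  finally show ?thesis
    using two_times_pent[of k] two_times_pent[of t] by linarith
qed

text \<open>The coefficient of \<open>x\<close> to the power \<open>28 p\<close>, where \<open>p\<close> is the \<open>t\<close>-th pentagonal number, vanishes
  on the right-hand side, while on the left-hand side the constant term of \<open>b\<close> contributes 1.\<close>
lemma quotient_nth_eq_1:
  assumes b: "b * fps_dilate 28 euler_bit = fps_dilate 4 euler_bit"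
    and t: "t > 0" "7 * pent t \<notin> range pent"
  obtains m where "14 * t - 7 \<le> int m" "m \<le> 7 * pent t" "b $ (4 * m) = 1"
proof (rule ccontr)
  note obtained = that
  assume "\<not> thesis"
  then have none: "b $ (4 * m) = 0" if "14 * t - 7 \<le> int m" "m \<le> 7 * pent t" for m
    using obtained that by fastforce
  define N where "N = 28 * pent t"
  have "b $ 0 = 1"
    using arg_cong[OF b, of "\<lambda>F. F $ 0"] by simp
  \<comment> \<open>A nonzero second factor forces i = 28 (\<open>pent t\<close> -
    \<open>pent k\<close>) with \<open>pent k\<close> < \<open>pent t\<close>. By the gap, i / 4 is
    at least 7 (2 t - 1), inside the range where b is assumed to vanish.\<close>
  have vanish: "b $ i * fps_dilate 28 euler_bit $ (N - i) = 0" if i: "0 < i" "i \<le> N" for i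
  proof (cases "fps_dilate 28 euler_bit $ (N - i) = 0")
    case False
    then obtain k where k: "28 dvd N - i" "(N - i) div 28 = pent k"
      by (auto simp: fps_dilate_nth euler_bit_nth split: if_splits)
    then have Ni: "N - i = 28 * pent k" by auto
    then have lt: "pent k < pent t" and i_eq: "i = 4 * (7 * (pent t - pent k))"
      using i by (auto simp: N_def)
    have "b $ i = 0"
      unfolding i_eq by (rule none) (use lt pent_gap[OF t(1) lt] in \<open>simp_all add: of_nat_diff\<close>)
    then show ?thesis by simp
  qed simp
  have "(\<Sum>i=Suc 0..N. b $ i * fps_dilate 28 euler_bit $ (N - i)) = 0"
    by (intro sum.neutral ballI vanish) simp_all
  then have "(b * fps_dilate 28 euler_bit) $ N = b $ 0 * fps_dilate 28 euler_bit $ N"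
    unfolding fps_mult_nth by (subst sum.atLeast_Suc_atMost) (simp_all only: add_0_right diff_zero le0)
  also have "\<dots> = 1"
    using \<open>b $ 0 = 1\<close> by (simp add: N_def fps_dilate_nth euler_bit_nth)
  finally have "fps_dilate 4 euler_bit $ N = 1" by (simp only: b)
  moreover have "fps_dilate 4 euler_bit $ N = 0"
    using t by (simp add: N_def fps_dilate_nth euler_bit_nth)
  ultimately show False by simp
qed

text \<open>Modulo 5, k (3 k - 1) takes only the values 0, 2 and 4, whereas 7 t (3 t - 1) = 3 for
  these t. This yields infinitely many t for the odd values.\<close>

lemma nonpentagonal_mod_5:
  assumes "t mod 5 = 3"
  shows "7 * pent t \<notin> range pent"
proof
  assume "7 * pent t \<in> range pent"
  then obtain k where "7 * pent t = pent k" by auto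
  then have "7 * (2 * int (pent t)) = 2 * int (pent k)" by simp
  then have eq: "7 * (t * (3 * t - 1)) = k * (3 * k - 1)"
    by (simp only: two_times_pent)
  define r where "r = k mod 5"
  have "[7 * (t * (3 * t - 1)) = 7 * (3 * (3 * 3 - 1))] (mod 5)"
    by (intro cong_mult cong_diff) (use assms in \<open>simp_all add: cong_def\<close>)
  moreover have "[k * (3 * k - 1) = r * (3 * r - 1)] (mod 5)"
    unfolding r_def by (intro cong_mult cong_diff) (simp_all add: cong_def)
  ultimately have "(r * (3 * r - 1)) mod 5 = 3"
    unfolding eq by (simp add: cong_def)
  moreover have "0 \<le> r" "r < 5" unfolding r_def by simp_all
  then have "r = 0 \<or> r = 1 \<or> r = 2 \<or> r = 3 \<or> r = 4" by linarith
  ultimately show False by (elim disjE) simp_all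
qed

section \<open>The q-expansions\<close>

lemma nome_7: "nome (7 * z) = nome z ^ 7"
  by (simp add: nome_def mult_ac flip: exp_of_nat_mult)

lemma f7_plus_eq:
  "f7_plus z = nome z powi (-1) * (euler_fun (nome z) ^ 4 / euler_fun (nome z ^ 7) ^ 4)"
proof -
  have eta: "dedekind_eta w = exp (2 * of_real pi * \<i> * w / 24) * euler_fun (nome w)" for w
    by (simp add: dedekind_eta_def euler_fun_def)
  \<comment> \<open>The eta prefactors combine to q^(4 (1 - 7) / 24) = q^(-1), the simple
    pole.\<close>
  have "(exp (2 * of_real pi * \<i> * z / 24) / exp (2 * of_real pi * \<i> * (7 * z) / 24)) ^ 4 =
      exp (of_nat 4 * (2 * of_real pi * \<i> * z / 24 - 2 * of_real pi * \<i> * (7 * z) / 24))"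
    by (simp only: exp_of_nat_mult exp_diff)
  also have "of_nat 4 * (2 * of_real pi * \<i> * z / 24 - 2 * of_real pi * \<i> * (7 * z) / 24) =
      - (2 * of_real pi * \<i> * z)"
    by (simp add: field_simps)
  also have "exp \<dots> = nome z powi (-1)"
    by (simp add: nome_def exp_minus power_int_minus)
  finally show ?thesis
    by (simp only: f7_plus_def eta nome_7 times_divide_times_eq[symmetric] power_mult_distrib
        power_divide)
qed

lemma j7_plus_eq:
  "j7_plus z = nome z powi (-1) * (euler_fun (nome z) ^ 4 / euler_fun (nome z ^ 7) ^ 4) + 4
     + 49 * (nome z powi 1 * (euler_fun (nome z ^ 7) ^ 4 / euler_fun (nome z) ^ 4))"
proof -
  have "(dedekind_eta (7 * z) / dedekind_eta z) ^ 4 = inverse (f7_plus z)"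
    by (simp add: f7_plus_def power_divide)
  also have "\<dots> = nome z powi 1 * (euler_fun (nome z ^ 7) ^ 4 / euler_fun (nome z) ^ 4)"
    by (simp add: f7_plus_eq power_int_minus divide_inverse mult_ac)
  finally have inv: "(dedekind_eta (7 * z) / dedekind_eta z) ^ 4 =
      nome z powi 1 * (euler_fun (nome z ^ 7) ^ 4 / euler_fun (nome z) ^ 4)" .
  have "j7_plus z = f7_plus z + 4 + 49 * (dedekind_eta (7 * z) / dedekind_eta z) ^ 4"
    by (simp add: j7_plus_def f7_plus_def)
  then show ?thesis
    by (simp only: inv f7_plus_eq)
qed

text \<open>By uniqueness it is enough to exhibit expansions: f starts at q^(-1), and 1 / f at
  q.\<close>

lemma
  assumes B: "disc_expansion (\<lambda>q. euler_fun q ^ 4 / euler_fun (q ^ 7) ^ 4) B"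
  shows a7_plus_eq: "a7_plus = laurent_coeff (-1) B"
    and c7_plus_eq: "disc_expansion (\<lambda>q. euler_fun (q ^ 7) ^ 4 / euler_fun q ^ 4) D \<Longrightarrow>
      c7_plus = (\<lambda>n. laurent_coeff (-1) B n + (if n = 0 then 4 else 0) + 49 * laurent_coeff 1 D n)"
proof -
  have nome: "nome z \<noteq> 0" for z by (simp add: nome_def)
  have f: "((\<lambda>n. laurent_coeff (-1) B n * nome z powi n) has_sum f7_plus z) UNIV" if "Im z > 0" for z
    unfolding f7_plus_eq using disc_expansion_has_sum[OF B nome norm_nome_less_1[OF that]] .
  have "\<forall>n < -1. laurent_coeff (-1) B n = 0"
    by (simp add: laurent_coeff_def)
  with f show "a7_plus = laurent_coeff (-1) B"
    unfolding a7_plus_def by (intro q_coeff_eqI) (unfold has_q_expansion_def, blast)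
  assume D: "disc_expansion (\<lambda>q. euler_fun (q ^ 7) ^ 4 / euler_fun q ^ 4) D"
  have "((\<lambda>n. (laurent_coeff (-1) B n + (if n = 0 then 4 else 0) + 49 * laurent_coeff 1 D n) * nome z powi n)
      has_sum j7_plus z) UNIV" if "Im z > 0" for z
  proof -
    have "((\<lambda>n. 49 * (laurent_coeff 1 D n * nome z powi n)) has_sum
        49 * (nome z powi 1 * (euler_fun (nome z ^ 7) ^ 4 / euler_fun (nome z) ^ 4))) UNIV"
      by (rule has_sum_cmult_right[OF disc_expansion_has_sum[OF D nome norm_nome_less_1[OF that]]])
    moreover have "((\<lambda>n. (if n = 0 then 4 else 0) * nome z powi n) has_sum 4) UNIV"
      by (rule has_sum_finite_neutralI[of "{0}"]) auto
    ultimately have "((\<lambda>n. laurent_coeff (-1) B n * nome z powi n + (if n = 0 then 4 else 0) * nome z powi n +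
        49 * (laurent_coeff 1 D n * nome z powi n)) has_sum j7_plus z) UNIV"
      unfolding j7_plus_eq f7_plus_eq[symmetric] by (intro has_sum_add f that)
    then show ?thesis by (simp only: distrib_right mult.assoc)
  qed
  moreover have "\<forall>n < -1. laurent_coeff (-1) B n + (if n = 0 then 4 else 0) + 49 * laurent_coeff 1 D n = 0"
    by (simp add: laurent_coeff_def)
  ultimately show "c7_plus = (\<lambda>n. laurent_coeff (-1) B n + (if n = 0 then 4 else 0) + 49 * laurent_coeff 1 D n)"
    unfolding c7_plus_def by (intro q_coeff_eqI) (unfold has_q_expansion_def, blast)
qed

section \<open>Parity of the coefficients\<close>

lemma odd_integer_of_int [simp]: "odd_integer (of_int k) \<longleftrightarrow> odd k"
  and even_integer_of_int [simp]: "even_integer (of_int k) \<longleftrightarrow> even k"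
  by (auto simp: odd_integer_def even_integer_def)

text \<open>\<open>B\<close> is the series of q f and \<open>D\<close> that of 1 / (q f), each with
  its equation modulo 2. The quotients exist on the whole disc since Euler's product has no zeros
  there.\<close>

lemma euler_quotients:
  obtains B D where "disc_expansion (\<lambda>q. euler_fun q ^ 4 / euler_fun (q ^ 7) ^ 4) B"
    "fps_of_ints B * fps_dilate 28 euler_bit = fps_dilate 4 euler_bit"
    "disc_expansion (\<lambda>q. euler_fun (q ^ 7) ^ 4 / euler_fun q ^ 4) D"
    "fps_of_ints D * fps_dilate 4 euler_bit = fps_dilate 28 euler_bit"
proof -
  \<comment> \<open>Dilation by 1 gives \<open>F\<close> the same shape as \<open>G\<close>, so one
    reduction lemma treats both.\<close>
  define F where "F = fps_dilate 1 euler_fps ^ 4"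
  define G where "G = fps_dilate 7 euler_fps ^ 4"
  have F: "disc_expansion (\<lambda>q. euler_fun q ^ 4) F"
    using disc_expansion_power[OF disc_expansion_dilate[OF disc_expansion_euler, of 1]]
    by (simp add: F_def)
  have G: "disc_expansion (\<lambda>q. euler_fun (q ^ 7) ^ 4) G"
    unfolding G_def by (intro disc_expansion_power disc_expansion_dilate[where f = euler_fun] disc_expansion_euler) simp
  have 1: "F $ 0 = 1" "G $ 0 = 1"
    by (simp_all add: F_def G_def fps_nth_power_0)
  have nz: "euler_fun q ^ 4 \<noteq> 0" "euler_fun (q ^ 7) ^ 4 \<noteq> 0" if "norm q < 1" for q
    using that by (simp_all add: euler_fun_nonzero norm_power power_less_one_iff)
  obtain B where B: "B * G = F" "disc_expansion (\<lambda>q. euler_fun q ^ 4 / euler_fun (q ^ 7) ^ 4) B"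
    using disc_expansion_divide[OF F G 1(2) nz(2)] by blast
  obtain D where D: "D * F = G" "disc_expansion (\<lambda>q. euler_fun (q ^ 7) ^ 4 / euler_fun q ^ 4) D"
    using disc_expansion_divide[OF G F 1(1) nz(1)] by blast
  have FG: "fps_of_ints F = fps_dilate 4 euler_bit" "fps_of_ints G = fps_dilate 28 euler_bit"
    by (simp_all add: F_def G_def fps_of_ints_euler_power4)
  show thesis
    by (rule that[OF B(2) _ D(2)]) (simp_all only: B(1) D(1) FG[symmetric] fps_of_ints_mult[symmetric])
qed

theorem theorem4p1:
  shows
    "(\<forall>t::int. t > 0 \<longrightarrow>
        (\<forall>l::nat. 7 * t * (3 * t - 1) \<noteq> int l * (3 * int l - 1) \<and>
                 7 * t * (3 * t - 1) \<noteq> int l * (3 * int l + 1)) \<longrightarrow>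
        (\<exists>n \<in> {56 * t - 29 .. 14 * t * (3 * t - 1) - 1}.
            [n = 3] (mod 4) \<and> odd_integer (a7_plus n))) \<and>
     (\<forall>t::int. t > 0 \<longrightarrow>
        (\<forall>l::nat. 14 * t * (6 * t - 1) \<noteq> int l * (3 * int l - 1) \<and>
                 14 * t * (6 * t - 1) \<noteq> int l * (3 * int l + 1)) \<longrightarrow>
        (\<exists>n \<in> {112 * t - 29 .. 28 * t * (6 * t - 1) - 1}.
            [n = 3] (mod 4) \<and> even_integer (a7_plus n))) \<and>
     infinite {n::int. n \<ge> 0 \<and> [n = 3] (mod 4) \<and> even_integer (c7_plus n)} \<and>
     infinite {n::int. n \<ge> 0 \<and> [n = 3] (mod 4) \<and> odd_integer (c7_plus n)}"
proof -
  obtain B D where B: "disc_expansion (\<lambda>q. euler_fun q ^ 4 / euler_fun (q ^ 7) ^ 4) B"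
      "fps_of_ints B * fps_dilate 28 euler_bit = fps_dilate 4 euler_bit"
    and D: "disc_expansion (\<lambda>q. euler_fun (q ^ 7) ^ 4 / euler_fun q ^ 4) D"
      "fps_of_ints D * fps_dilate 4 euler_bit = fps_dilate 28 euler_bit"
    by (rule euler_quotients)
  \<comment> \<open>Exponents n = 3 modulo 4 are written 4 m - 1; the pole shifts them to 4 m in
    \<open>B\<close>.\<close>
  have a: "a7_plus (4 * int m - 1) = of_int (B $ (4 * m))" for m
    by (simp add: a7_plus_eq[OF B(1)] laurent_coeff_def nat_mult_distrib)
  have c: "\<exists>k. c7_plus (4 * int m - 1) = of_int k \<and> (even k \<longleftrightarrow> even (B $ (4 * m)))" if "m > 0" for m
  proof -
    \<comment> \<open>The coefficient of 1 / f at 4 m - 1 is that of \<open>D\<close> at 4 m - 2,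
      which is not divisible by 4.\<close>
    define i where "i = 4 * (m - 1) + 2"
    have i: "nat (4 * int m - 2) = i" using that unfolding i_def by simp
    have "\<not> 4 dvd i" unfolding i_def by presburger
    then have "fps_of_ints D $ i = (0 :: bit)" by (rule quotient_nth_eq_0_mod_4[OF D(2)])
    then have "even (D $ i)" by simp
    moreover have "c7_plus (4 * int m - 1) = of_int (B $ (4 * m) + 49 * D $ i)"
      using that by (simp add: c7_plus_eq[OF B(1) D(1)] laurent_coeff_def i nat_mult_distrib)
    ultimately show ?thesis by (intro exI[of _ "B $ (4 * m) + 49 * D $ i"]) simp
  qed
  have cong3: "[4 * int m - 1 = 3] (mod 4)" for m
    by (simp add: cong_iff_dvd_diff)
  have odd_B: "\<exists>m. 14 * t - 7 \<le> int m \<and> m \<le> 7 * pent t \<and> odd (B $ (4 * m))"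
    if t: "t > 0" "7 * pent t \<notin> range pent" for t
  proof -
    obtain m where "14 * t - 7 \<le> int m" "m \<le> 7 * pent t" "fps_of_ints B $ (4 * m) = (1 :: bit)"
      using quotient_nth_eq_1[OF B(2) t] by blast
    moreover from this have "odd (B $ (4 * m))"
      by (metis fps_of_ints_nth of_int_bit_eq_0_iff zero_neq_one)
    ultimately show ?thesis by blast
  qed
  have even_B: "even (B $ (4 * m))" if "m mod 7 = 3" for m
    using quotient_nth_eq_0_mod_7[OF B(2) that] by simp
  have part_a: "\<exists>n \<in> {56 * t - 29 .. 14 * t * (3 * t - 1) - 1}. [n = 3] (mod 4) \<and> odd_integer (a7_plus n)"
    if "t > 0" and l: "\<forall>l::nat. 7 * t * (3 * t - 1) \<noteq> int l * (3 * int l - 1) \<and>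
      7 * t * (3 * t - 1) \<noteq> int l * (3 * int l + 1)" for t
  proof -
    have "7 * pent t \<notin> range pent"
    proof
      assume "7 * pent t \<in> range pent"
      then obtain k where "7 * pent t = pent k" by auto
      then have "7 * (2 * int (pent t)) = 2 * int (pent k)" by simp
      then have "7 * t * (3 * t - 1) = k * (3 * k - 1)"
        by (simp only: two_times_pent mult.assoc)
      \<comment> \<open>With l = |k|, the sign of k decides which of the two excluded forms
        occurs.\<close>
      then show False
        using l[rule_format, of "nat \<bar>k\<bar>"] by (cases "k \<ge> 0") (simp_all add: algebra_simps)
    qed
    then obtain m where m: "14 * t - 7 \<le> int m" "m \<le> 7 * pent t" "odd (B $ (4 * m))"
      using odd_B \<open>t > 0\<close> by blast
    \<comment> \<open>The bounds on m become those on n = 4 m - 1: 4 (14 t - 7) - 1 = 56 t - 29, and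
      28 \<open>pent t\<close> = 14 t (3 t - 1).\<close>
    have "4 * int m \<le> 14 * (2 * int (pent t))" using m(2) by linarith
    then have "4 * int m \<le> 14 * t * (3 * t - 1)"
      by (simp only: two_times_pent mult.assoc)
    with m show ?thesis
      by (intro bexI[of _ "4 * int m - 1"] conjI cong3) (simp_all add: a)
  qed
  have part_b: "\<exists>n \<in> {112 * t - 29 .. 28 * t * (6 * t - 1) - 1}. [n = 3] (mod 4) \<and> even_integer (a7_plus n)"
    if "t > 0" for t
  proof -
    \<comment> \<open>The least m = 3 modulo 7 with 4 m - 1 >= 112 t - 29.\<close>
    define m where "m = nat (28 * t - 4)"
    have "m = 7 * nat (4 * t - 1) + 3" unfolding m_def using that by simp
    then have "m mod 7 = 3" by simp
    have m: "int m = 28 * t - 4" unfolding m_def using that by simp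
    have "4 * int m \<le> 28 * t * 5"
      unfolding m using that by simp
    also have "\<dots> \<le> 28 * t * (6 * t - 1)"
      using that by (intro mult_left_mono) auto
    finally have "4 * int m \<le> 28 * t * (6 * t - 1)" .
    with m have "4 * int m - 1 \<in> {112 * t - 29 .. 28 * t * (6 * t - 1) - 1}"
      by simp
    moreover have "even_integer (a7_plus (4 * int m - 1))"
      using even_B[OF \<open>m mod 7 = 3\<close>] by (simp only: a even_integer_of_int)
    ultimately show ?thesis using cong3 by blast
  qed
  have even_c: "infinite {n::int. n \<ge> 0 \<and> [n = 3] (mod 4) \<and> even_integer (c7_plus n)}"
    unfolding infinite_int_iff_unbounded
  proof
    fix N :: int
    define m where "m = 7 * nat \<bar>N\<bar> + 3"
    obtain k where "c7_plus (4 * int m - 1) = of_int k" "even k"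
      using c[of m] even_B[of m] by (auto simp: m_def)
    then show "\<exists>n. N < \<bar>n\<bar> \<and> n \<in> {n. n \<ge> 0 \<and> [n = 3] (mod 4) \<and> even_integer (c7_plus n)}"
      using cong3[of m] by (intro exI[of _ "4 * int m - 1"]) (auto simp: m_def)
  qed
  have odd_c: "infinite {n::int. n \<ge> 0 \<and> [n = 3] (mod 4) \<and> odd_integer (c7_plus n)}"
    unfolding infinite_int_iff_unbounded
  proof
    fix N :: int
    \<comment> \<open>Congruent to 3 modulo 5 and so large that m >= 14 t - 7 pushes 4 m - 1 beyond
      N.\<close>
    define t where "t = 5 * \<bar>N\<bar> + 3"
    have "t > 0" "t mod 5 = 3" "N \<le> t" by (simp_all add: t_def)
    then obtain m where m: "14 * t - 7 \<le> int m" "odd (B $ (4 * m))"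
      using odd_B nonpentagonal_mod_5 by blast
    then have "m > 0" using \<open>t > 0\<close> by linarith
    then obtain k where "c7_plus (4 * int m - 1) = of_int k" "odd k"
      using c[of m] m(2) by auto
    moreover have "N < 4 * int m - 1"
      using m(1) \<open>t > 0\<close> \<open>N \<le> t\<close> by linarith
    ultimately show "\<exists>n. N < \<bar>n\<bar> \<and> n \<in> {n. n \<ge> 0 \<and> [n = 3] (mod 4) \<and> odd_integer (c7_plus n)}"
      using cong3[of m] \<open>m > 0\<close> by (intro exI[of _ "4 * int m - 1"]) auto
  qed
  show ?thesis
    using part_a part_b even_c odd_c by blast
qed

end
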